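(* Let $c=5.28$ and $d=6$. Then asymptotically almost surely $\mathcal{G}(cn,d/n)\to P_n$. Consequently $\hat{R}(P_n)<83.7n$ for all sufficiently large $n$.
   Context: $\mathcal{G}(N,p)$ is the binomial random graph on vertex set $\{1,\dots,N\}$ in which each pair is an edge independently with probability $p$ (here $N=cn$, rounded to an integer). $P_n$ is the path on $n$ vertices; $G\to P_n$ means every 2-colouring of the edges of $G$ contains a monochromatic copy of $P_n$; $\hat{R}(P_n)=\min\{|E(G)|:G\to P_n\}$. Asymptotically almost surely (a.a.s.) means with probability tending to $1$ as $n\to\infty$. *)

theory Defs
  imports "HOL-Probability.Probability" "HOL-Library.Ramsey"
begin

type_synonym 'a graph = "'a set \<times> 'a set set"

abbreviation verts :: "'a graph \<Rightarrow> 'a set" where "verts \<equiv> fst"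

abbreviation edges :: "'a graph \<Rightarrow> 'a set set" where "edges \<equiv> snd"

definition fin_simple_graph :: "'a graph \<Rightarrow> bool" where
  "fin_simple_graph G \<longleftrightarrow> finite (verts G) \<and> edges G \<subseteq> [verts G]\<^bsup>2\<^esup>"

definition path_graph :: "nat \<Rightarrow> nat graph" where
  "path_graph n = ({..<n}, {{i, Suc i} | i. Suc i < n})"

(* A copy of H in G is a subgraph, not necessarily induced. *)
definition contains_copy :: "'a graph \<Rightarrow> 'b graph \<Rightarrow> bool" where
  "contains_copy G H \<longleftrightarrow>
     (\<exists>f. inj_on f (verts H) \<and> f ` verts H \<subseteq> verts G \<and> (\<forall>e \<in> edges H. f ` e \<in> edges G))"

(* Values of the colouring outside the edge set are irrelevant. *)
definition arrows :: "'a graph \<Rightarrow> 'b graph \<Rightarrow> bool" where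
  "arrows G H \<longleftrightarrow>
     (\<forall>\<phi> :: 'a set \<Rightarrow> bool. \<exists>b. contains_copy (verts G, {e \<in> edges G. \<phi> e = b}) H)"

(* Every finite graph is isomorphic to one whose vertices are natural numbers, so restricting G to
   the type nat loses nothing. *)
definition size_ramsey :: "'b graph \<Rightarrow> nat" where
  "size_ramsey H = (LEAST m. \<exists>G :: nat graph. fin_simple_graph G \<and> arrows G H \<and> card (edges G) = m)"

(* Ramsey's theorem, so the minimum defining size_ramsey is over a nonempty set. *)
lemma ex_arrows:
  fixes H :: "'b graph"
  assumes "fin_simple_graph H"
  shows "\<exists>G :: nat graph. fin_simple_graph G \<and> arrows G H"
proof -
  define k where "k = card (verts H)"
  obtain M where M: "partn_lst {..<M::nat} [k,k] 2"
    using ramsey2_full by blast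
  define G where "G = ({..<M}, [{..<M}]\<^bsup>2\<^esup>)"
  have "arrows G H"
    unfolding arrows_def
  proof
    fix \<phi> :: "nat set \<Rightarrow> bool"
    define f :: "nat set \<Rightarrow> nat" where "f = (\<lambda>e. if \<phi> e then 1 else 0)"
    have "f \<in> [{..<M}]\<^bsup>2\<^esup> \<rightarrow> {..<length [k,k]}"
      by (auto simp: f_def)
    with M obtain i where i: "i < length [k,k]" "monochromatic {..<M} ([k,k] ! i) 2 f i"
      unfolding partn_lst_def by blast
    then have "[k,k] ! i = k"
      by (auto simp: less_Suc_eq)
    with i obtain S where S: "S \<in> [{..<M}]\<^bsup>k\<^esup>" and fS: "f ` [S]\<^bsup>2\<^esup> \<subseteq> {i}"
      unfolding monochromatic_def by auto
    obtain g where g: "bij_betw g (verts H) S"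
      using S assms finite_same_card_bij[of "verts H" S]
      by (auto simp: nsets_def k_def fin_simple_graph_def)
    have "g ` e \<in> edges G \<and> \<phi> (g ` e) = (i = 1)" if "e \<in> edges H" for e
    proof -
      have "e \<in> [verts H]\<^bsup>2\<^esup>"
        using that assms by (auto simp: fin_simple_graph_def)
      then have "g ` e \<in> [S]\<^bsup>2\<^esup>"
        using bij_betw_nsets[OF g, of 2] by (auto simp: bij_betw_def)
      moreover have "[S]\<^bsup>2\<^esup> \<subseteq> edges G"
        using S nsets_mono[of S "{..<M}" 2] by (simp add: G_def nsets_def)
      ultimately have "g ` e \<in> edges G" "f (g ` e) = i"
        using fS by blast+
      then show ?thesis
        by (cases "\<phi> (g ` e)") (simp_all add: f_def)
    qed
    moreover have "inj_on g (verts H)" "g ` verts H \<subseteq> verts G"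
      using g S by (auto simp: bij_betw_def G_def nsets_def)
    ultimately have "contains_copy (verts G, {e \<in> edges G. \<phi> e = (i = 1)}) H"
      unfolding contains_copy_def by auto
    then show "\<exists>b. contains_copy (verts G, {e \<in> edges G. \<phi> e = b}) H" ..
  qed
  moreover have "fin_simple_graph G"
    by (simp add: G_def fin_simple_graph_def)
  ultimately show ?thesis
    by blast
qed

lemma fin_simple_graph_path_graph: "fin_simple_graph (path_graph n)"
  by (auto simp: fin_simple_graph_def path_graph_def)

(* bernoulli_pmf truncates its parameter to [0,1], so p = d / n > 1 for small n is harmless. *)
definition binomial_random_graph :: "nat \<Rightarrow> real \<Rightarrow> nat graph pmf" where
  "binomial_random_graph N p =
     map_pmf (\<lambda>\<omega>. ({1..N}, {e \<in> [{1..N}]\<^bsup>2\<^esup>. \<omega> e}))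
       (Pi_pmf ([{1..N}]\<^bsup>2\<^esup>) False (\<lambda>_. bernoulli_pmf p))"

end

theory Submission
  imports Defs
begin

text \<open>
  Depth-first search splits the vertices of a graph into a set \<open>U\<close> of prescribed size, a path and a rest
  \<open>W\<close> without edges between \<open>U\<close> and \<open>W\<close>. If a 2-coloured graph on \<open>c n\<close> vertices has no
  monochromatic \<open>P\<^sub>n\<close>, a search along one colour yields sets \<open>S\<close>, \<open>T\<close> of size about \<open>(c - 1) n / 2\<close>
  all of whose mutual edges have the other colour. A path of that colour between \<open>S\<close> and \<open>T\<close>
  alternates, so it uses at most \<open>n / 2\<close> vertices of each, and a second search, stopped at
  \<open>m \<approx> (c - 2) n / 2\<close> finished vertices, gives disjoint sets \<open>A\<close>, \<open>B\<close>, \<open>C\<close>, \<open>D\<close> with \<open>|A| = |B|\<close>,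
  \<open>|C| = |D|\<close>, \<open>|A| + |C| = m\<close> and no edge of either colour between \<open>A\<close> and \<open>B\<close> or \<open>C\<close> and \<open>D\<close>.
  At least \<open>m\<^sup>2 / 2\<close> pairs are thus missing, and the union bound over all such quadruples succeeds by
  a narrow margin. Markov's inequality for the number of edges gives the bound on the size-Ramsey number.
\<close>

section \<open>Depth-first search and graphs without a monochromatic path\<close>

text \<open>Induction on the number \<open>k\<close> of finished vertices: \<open>p\<close> is the
  search stack with its top at the head, \<open>U\<close> holds the finished and \<open>W\<close>
  the unvisited vertices. Once the stack cannot grow, its top \<open>v\<close> has no
  \<open>w\<close> in \<open>W\<close> with \<open>R w v\<close>, so it may move to
  \<open>U\<close>.\<close>

lemma dfs_partition:
  fixes R :: "'a \<Rightarrow> 'a \<Rightarrow> bool"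
  assumes "finite V" "k \<le> card V"
  shows "\<exists>p U W. distinct p \<and> successively R p \<and> V = U \<union> set p \<union> W
    \<and> U \<inter> set p = {} \<and> U \<inter> W = {} \<and> set p \<inter> W = {} \<and> card U = k
    \<and> (\<forall>u\<in>U. \<forall>w\<in>W. \<not> R w u)"
proof -
  define Q where "Q k p U W \<longleftrightarrow> distinct p \<and> successively R p \<and> V = U \<union> set p \<union> W
    \<and> U \<inter> set p = {} \<and> U \<inter> W = {} \<and> set p \<inter> W = {} \<and> card U = k
    \<and> (\<forall>u\<in>U. \<forall>w\<in>W. \<not> R w u)" for k :: nat and p U W
  have "\<exists>p U W. Q k p U W" using assms(2)
  proof (induction k)
    case 0
    have "Q 0 [] {} V" by (simp add: Q_def)
    then show ?case by blast
  next
    case (Suc k)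
    then obtain p0 U0 W0 where "Q k p0 U0 W0" by auto
    \<comment> \<open>Taking \<open>W\<close> of least size replaces running the search: no vertex
      of \<open>W\<close> can be pushed any more.\<close>
    then obtain x where x: "case x of (p, U, W) \<Rightarrow> Q k p U W"
      and min: "\<And>y. (case y of (p, U, W) \<Rightarrow> Q k p U W) \<Longrightarrow> card (snd (snd x)) \<le> card (snd (snd y))"
      using ex_has_least_nat[of "\<lambda>(p, U, W). Q k p U W" "(p0, U0, W0)" "\<lambda>x. card (snd (snd x))"]
      by auto
    obtain p U W where [simp]: "x = (p, U, W)" by (cases x)
    have q: "Q k p U W" using x by simp
    have fin: "finite U" "finite W"
      using q assms(1) by (auto simp: Q_def)
    have no_ext: "\<not> Q k (w # p) U (W - {w})" if "w \<in> W" for w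
      using min[of "(w # p, U, W - {w})"] card_Diff1_less[OF fin(2) that] by auto
    show ?case
    proof (cases p)
      case Nil
      \<comment> \<open>Since \<open>k < card V\<close>, an empty stack leaves an unvisited vertex,
        which could be pushed.\<close>
      have "W \<noteq> {}" using q Suc.prems Nil by (auto simp: Q_def)
      then obtain w where "w \<in> W" by blast
      moreover from this have "Q k (w # p) U (W - {w})"
        using q Nil by (auto simp: Q_def)
      ultimately show ?thesis using no_ext by blast
    next
      case (Cons v q')
      have "\<not> R w v" if w: "w \<in> W" for w
      proof
        assume "R w v"
        with w q Cons have "Q k (w # p) U (W - {w})"
          by (auto simp: Q_def)
        with no_ext w show False by blast
      qed
      with q Cons fin have "Q (Suc k) q' (insert v U) W"
        by (auto simp: Q_def successively_Cons)
      then show ?thesis by blast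
    qed
  qed
  then show ?thesis unfolding Q_def .
qed

lemma contains_copy_path_graph:
  assumes "distinct p" "set p \<subseteq> V" "successively (\<lambda>u v. {u, v} \<in> E) p" "n \<le> length p"
  shows "contains_copy (V, E) (path_graph n)"
proof -
  have "inj_on (\<lambda>i. p ! i) {..<n}" using assms by (auto simp: inj_on_def nth_eq_iff_index_eq)
  moreover have "{p ! i, p ! Suc i} \<in> E" if "Suc i < n" for i
    using assms that by (auto simp: successively_conv_nth)
  ultimately show ?thesis using assms
    unfolding contains_copy_def path_graph_def
    by (intro exI[of _ "\<lambda>i. p ! i"]) (auto simp: subset_iff)
qed

text \<open>Of two consecutive elements exactly one satisfies \<open>P\<close>, so the induction
  removes two at a time. The \<open>+ 1\<close> is attained by lists of odd length that start with
  \<open>P\<close>.\<close>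

lemma length_filter_alternating:
  assumes "successively (\<lambda>u v. P u \<noteq> P v) p"
  shows "2 * length (filter P p) \<le> length p + 1"
  using assms
proof (induction p rule: induct_list012)
  case (3 x y zs)
  then show ?case by (cases zs) auto
qed auto

lemma card_alternating_path:
  assumes "distinct p" "successively (\<lambda>u v. u \<in> A \<longleftrightarrow> v \<notin> A) p"
  shows "2 * card (set p \<inter> A) \<le> length p + 1"
proof -
  have "card (set p \<inter> A) = length (filter (\<lambda>v. v \<in> A) p)"
    using assms(1) by (metis distinct_card distinct_filter set_filter Int_def)
  moreover have "successively (\<lambda>u v. (u \<in> A) \<noteq> (v \<in> A)) p"
    by (rule successively_mono[OF assms(2)]) auto
  ultimately show ?thesis using length_filter_alternating by metis
qed

text \<open>The labels 0, 1, 2, 3 mark \<open>A\<close>, \<open>B\<close>, \<open>C\<close>, \<open>D\<close>; the label 4 marks all other vertices.\<close>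

lemma not_arrows_path_labelling:
  fixes V :: "'a set"
  assumes V: "finite V" and card: "2 * m + 2 * n \<le> card V"
    and na: "\<not> arrows (V, E) (path_graph n)"
  shows "\<exists>f \<in> V \<rightarrow>\<^sub>E {..<5::nat}. card {v \<in> V. f v = 0} = card {v \<in> V. f v = 1}
    \<and> card {v \<in> V. f v = 2} = card {v \<in> V. f v = 3}
    \<and> card {v \<in> V. f v = 0} + card {v \<in> V. f v = 2} = m
    \<and> (\<forall>u\<in>V. \<forall>v\<in>V. f u = 0 \<and> f v = 1 \<or> f u = 2 \<and> f v = 3 \<longrightarrow> {u, v} \<notin> E)"
proof -
  obtain \<phi> :: "'a set \<Rightarrow> bool" where \<phi>: "\<And>b. \<not> contains_copy (V, {e \<in> E. \<phi> e = b}) (path_graph n)"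
    using na unfolding arrows_def by auto
  have short: "length p < n" if "distinct p" "set p \<subseteq> V"
      "successively (\<lambda>u v. {u, v} \<in> {e \<in> E. \<phi> e = b}) p" for p b
    using contains_copy_path_graph[OF that, of n] \<phi>[of b] by fastforce
  \<comment> \<open>The largest \<open>k\<close> such that removing \<open>k\<close> finished
    vertices and a path of at most \<open>n - 1\<close> vertices still leaves \<open>k\<close>
    vertices in \<open>W\<close>.\<close>
  define k where "k = (card V + 1 - n) div 2"
  have "k \<le> card V" unfolding k_def by linarith
  from dfs_partition[OF V this, of "\<lambda>u v. {u, v} \<in> {e \<in> E. \<phi> e = True}"]
  obtain p S W where p: "distinct p" "successively (\<lambda>u v. {u, v} \<in> {e \<in> E. \<phi> e = True}) p"
    and VSW: "V = S \<union> set p \<union> W" "S \<inter> set p = {}" "S \<inter> W = {}" "set p \<inter> W = {}" "card S = k"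
    and SW: "\<And>u w. u \<in> S \<Longrightarrow> w \<in> W \<Longrightarrow> \<not> ({w, u} \<in> E \<and> \<phi> {w, u} = True)"
    by auto
  have fin: "finite S" "finite W" using V VSW(1) by auto
  have lp: "length p < n" using short p VSW(1) by blast
  have "card V = k + length p + card W"
    using VSW fin p(1) by (simp add: card_Un_disjoint distinct_card Int_Un_distrib2)
  then have "k \<le> card W" using lp card unfolding k_def by linarith
  then obtain T where T: "T \<subseteq> W" "card T = k" "finite T"
    using obtain_subset_with_card_n by metis
  have ST: "S \<inter> T = {}" "S \<subseteq> V" "T \<subseteq> V" using T VSW by auto
  have blue: "\<phi> {u, w} = False" if "u \<in> S" "w \<in> T" "{u, w} \<in> E" for u w
    using SW[of u w] that T by (auto simp: insert_commute)
  \<comment> \<open>All edges between \<open>S\<close> and \<open>T\<close> have colour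
    \<open>False\<close>, so on \<open>S \<union> T\<close> an \<open>R\<close>-path is
    monochromatic, while absence of \<open>R\<close> across the two sides means absence of an edge
    of either colour.\<close>
  define R where "R u v \<longleftrightarrow> {u, v} \<in> E \<and> (u \<in> S \<longleftrightarrow> v \<notin> S)" for u v
  have cST: "card (S \<union> T) = 2 * k" using ST fin T VSW by (simp add: card_Un_disjoint)
  have k2: "2 * m + n \<le> 2 * k" using card unfolding k_def by linarith
  have "finite (S \<union> T)" "m \<le> card (S \<union> T)" using fin T cST k2 by auto
  from dfs_partition[OF this, of R]
  obtain q U X where q: "distinct q" "successively R q"
    and UX: "S \<union> T = U \<union> set q \<union> X" "U \<inter> set q = {}" "U \<inter> X = {}" "set q \<inter> X = {}" "card U = m"
    and nR: "\<And>u w. u \<in> U \<Longrightarrow> w \<in> X \<Longrightarrow> \<not> R w u"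
    by auto
  have finUX: "finite U" "finite X" using \<open>finite (S \<union> T)\<close> UX(1) by auto
  have qST: "set q \<subseteq> S \<union> T" using UX by auto
  have RST: "{u, v} \<in> {e \<in> E. \<phi> e = False}" if "R u v" "u \<in> S \<union> T" "v \<in> S \<union> T" for u v
    using that blue[of u v] blue[of v u] by (auto simp: R_def insert_commute)
  have "successively (\<lambda>u v. {u, v} \<in> {e \<in> E. \<phi> e = False}) q"
    by (rule successively_mono[OF q(2)]) (use RST qST in blast)
  then have lq: "length q < n" using short q(1) qST ST by blast
  have altS: "successively (\<lambda>u v. u \<in> S \<longleftrightarrow> v \<notin> S) q"
    by (rule successively_mono[OF q(2)]) (auto simp: R_def)
  have altT: "successively (\<lambda>u v. u \<in> T \<longleftrightarrow> v \<notin> T) q"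
    by (rule successively_mono[OF altS]) (use qST ST in blast)
  \<comment> \<open>The \<open>+ 1\<close> for alternating paths is absorbed by
    \<open>length q < n\<close>.\<close>
  have cS: "2 * card (set q \<inter> S) \<le> n" using card_alternating_path[OF q(1) altS] lq by linarith
  have cT: "2 * card (set q \<inter> T) \<le> n" using card_alternating_path[OF q(1) altT] lq by linarith
  have split: "card Y = card (U \<inter> Y) + card (set q \<inter> Y) + card (X \<inter> Y)" if "Y \<subseteq> S \<union> T" for Y
  proof -
    have "Y = (U \<inter> Y) \<union> ((set q \<inter> Y) \<union> (X \<inter> Y))" using that UX(1) by blast
    moreover have "card ((U \<inter> Y) \<union> ((set q \<inter> Y) \<union> (X \<inter> Y)))
        = card (U \<inter> Y) + card ((set q \<inter> Y) \<union> (X \<inter> Y))"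
      by (rule card_Un_disjoint) (use finUX UX(2,3) in auto)
    moreover have "card ((set q \<inter> Y) \<union> (X \<inter> Y)) = card (set q \<inter> Y) + card (X \<inter> Y)"
      by (rule card_Un_disjoint) (use finUX UX(4) in auto)
    ultimately show ?thesis by simp
  qed
  have UST: "card (U \<inter> S) + card (U \<inter> T) = m"
  proof -
    have "U = (U \<inter> S) \<union> (U \<inter> T)" using UX by blast
    moreover have "card ((U \<inter> S) \<union> (U \<inter> T)) = card (U \<inter> S) + card (U \<inter> T)"
      using finUX ST by (intro card_Un_disjoint) auto
    ultimately show ?thesis using UX by simp
  qed
  \<comment> \<open>Of the \<open>k \<ge> m + n / 2\<close> vertices of \<open>T\<close>, the path
    takes at most \<open>n / 2\<close> and \<open>U\<close> takes
    \<open>m - card (U \<inter> S)\<close>; the rest lies in \<open>X\<close>. The same count with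
    \<open>S\<close> and \<open>T\<close> exchanged yields \<open>D\<close>.\<close>
  have "card (U \<inter> S) \<le> card (X \<inter> T)" using split[of T] T UST cT k2 by simp
  then obtain B where B: "B \<subseteq> X \<inter> T" "card B = card (U \<inter> S)"
    using obtain_subset_with_card_n by metis
  have "card (U \<inter> T) \<le> card (X \<inter> S)" using split[of S] VSW UST cS k2 by simp
  then obtain D where D: "D \<subseteq> X \<inter> S" "card D = card (U \<inter> T)"
    using obtain_subset_with_card_n by metis
  define f where "f = (\<lambda>v\<in>V. if v \<in> U \<inter> S then 0 else if v \<in> B then 1 else if v \<in> U \<inter> T then 2
    else if v \<in> D then 3 else (4::nat))"
  have cls: "{v \<in> V. f v = 0} = U \<inter> S" "{v \<in> V. f v = 1} = B" "{v \<in> V. f v = 2} = U \<inter> T"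
    "{v \<in> V. f v = 3} = D"
    using B D UX ST by (auto simp: f_def split: if_splits)
  have "{u, v} \<notin> E" if uv: "u \<in> V" "v \<in> V" "f u = 0 \<and> f v = 1 \<or> f u = 2 \<and> f v = 3" for u v
  proof -
    have "u \<in> U \<inter> S \<and> v \<in> B \<or> u \<in> U \<inter> T \<and> v \<in> D"
      using uv cls by blast
    then have "u \<in> U" "v \<in> X" "u \<in> S \<longleftrightarrow> v \<notin> S" using B D ST by blast+
    with nR[of u v] show ?thesis by (auto simp: R_def insert_commute)
  qed
  moreover have "f \<in> V \<rightarrow>\<^sub>E {..<5}" by (auto simp: f_def)
  ultimately show ?thesis
    using cls B D UST by (intro bexI[of _ f]) auto
qed

section \<open>Numerical bound on the entropy\<close>

text \<open>The quadratic Taylor polynomial is a lower bound for \<open>exp x\<close>; an upper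
  bound on a logarithm thus reduces to comparing rational powers.\<close>

lemma ln_le_of_le_power:
  fixes x y :: real
  assumes "0 \<le> x" "0 < y" "y \<le> (1 + x + x\<^sup>2 / 2) ^ n"
  shows "ln y \<le> real n * x"
proof -
  have "(1 + x + x\<^sup>2 / 2) ^ n \<le> exp x ^ n"
    using assms(1) by (intro power_mono exp_lower_Taylor_quadratic) auto
  with assms(3) have "y \<le> exp (real n * x)" by (simp add: exp_of_nat_mult)
  with assms(2) have "ln y \<le> ln (exp (real n * x))" by (subst ln_le_cancel_iff) auto
  then show ?thesis by simp
qed

text \<open>Here \<open>264 / 41 = 4 * 5.28 / 3.28\<close>, \<open>66 / 25 = 5.28 / 2\<close> and \<open>8.0688 = 3 * 1.64\<^sup>2\<close>; the left-hand
  side is about \<open>8.0502\<close>.\<close>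

lemma entropy_less_exponent:
  "3.28 * ln (264 / 41) + 2 * ln (66 / 25) < (8.0688 :: real)"
proof -
  \<comment> \<open>\<open>583 / 10000\<close> is slightly above \<open>ln (264 / 41) / 32\<close>,
    and \<open>105999 / 100000\<close> is its Taylor polynomial cut to five decimals, which keeps
    the power small enough to evaluate. The bound for \<open>66 / 25\<close> is obtained likewise;
    the total is \<open>8.064768\<close>.\<close>
  have "264 / 41 \<le> (105999 / 100000 :: real) ^ 32"
    by (simp add: power_divide)
  also have "\<dots> \<le> (1 + 583 / 10000 + (583 / 10000)\<^sup>2 / 2) ^ 32"
    by (intro power_mono) (simp_all add: power_divide)
  finally have "ln (264 / 41) \<le> real 32 * (583 / 10000 :: real)"
    by (intro ln_le_of_le_power) auto
  moreover have "66 / 25 \<le> (103086 / 100000 :: real) ^ 32"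
    by (simp add: power_divide)
  then have "66 / 25 \<le> (1 + 304 / 10000 + (304 / 10000)\<^sup>2 / 2 :: real) ^ 32"
    by (rule order_trans) (intro power_mono; simp add: power_divide)
  then have "ln (66 / 25) \<le> real 32 * (304 / 10000 :: real)"
    by (intro ln_le_of_le_power) auto
  ultimately show ?thesis by simp
qed

section \<open>Counting labellings and the union bound\<close>

text \<open>Independent random labels, each of 0, 1, 2, 3 with probability \<open>q / 4\<close> and 4 with probability
  \<open>1 - q\<close>, produce every labelling counted here with the same probability.\<close>

lemma card_labellings_le:
  fixes V :: "'a set" and q :: real
  assumes V: "finite V" and q: "0 < q" "q < 1" and "k \<le> card V"
  shows "card {f \<in> V \<rightarrow>\<^sub>E {..<5::nat}. card {v \<in> V. f v < 4} = k}
    \<le> (4 / q) ^ k * (1 / (1 - q)) ^ (card V - k)"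
proof -
  define w where "w j = (if j < 4 then q / 4 else 1 - q)" for j :: nat
  define L where "L = {f \<in> V \<rightarrow>\<^sub>E {..<5::nat}. card {v \<in> V. f v < 4} = k}"
  have prod_w: "(\<Prod>v\<in>V. w (f v)) = (q / 4) ^ k * (1 - q) ^ (card V - k)" if "f \<in> L" for f
  proof -
    have k: "card {v \<in> V. f v < 4} = k" using that by (simp add: L_def)
    have "card (V \<inter> {v. f v < 4}) = k" using k by (simp add: Int_def)
    moreover have "card (V \<inter> - {v. f v < 4}) = card V - k"
      using V calculation by (metis Diff_eq card_Diff_subset_Int finite_Int)
    ultimately show ?thesis
      unfolding w_def using V by (simp add: prod.If_cases)
  qed
  have "(\<Sum>f\<in>L. (\<Prod>v\<in>V. w (f v))) \<le> (\<Sum>f\<in>V \<rightarrow>\<^sub>E {..<5}. \<Prod>v\<in>V. w (f v))"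
    by (rule sum_mono2) (use V q in \<open>auto simp: L_def w_def intro!: finite_PiE prod_nonneg\<close>)
  also have "\<dots> = (\<Prod>v\<in>V. \<Sum>j<5. w j)"
    by (rule prod_sum_PiE [symmetric]) (use V in auto)
  also have "(\<Sum>j<5. w j) = 1" by (simp add: w_def eval_nat_numeral)
  finally have "card L * ((q / 4) ^ k * (1 - q) ^ (card V - k)) \<le> 1"
    by (simp add: prod_w)
  with q show ?thesis unfolding L_def [symmetric] by (simp add: field_simps power_divide)
qed

lemma prob_Pi_pmf_bernoulli_all_False:
  assumes "finite I" "Z \<subseteq> I" "0 \<le> p" "p \<le> 1"
  shows "measure_pmf.prob (Pi_pmf I False (\<lambda>_. bernoulli_pmf p)) {\<omega>. \<forall>e\<in>Z. \<not> \<omega> e} = (1 - p) ^ card Z"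
proof -
  have "{\<omega>. \<forall>e\<in>Z. \<not> \<omega> e} = Pi I (\<lambda>e. if e \<in> Z then {False} else UNIV)"
    using assms(2) by (auto simp: Pi_def split: if_splits)
  then have "measure_pmf.prob (Pi_pmf I False (\<lambda>_. bernoulli_pmf p)) {\<omega>. \<forall>e\<in>Z. \<not> \<omega> e}
      = (\<Prod>e\<in>I. if e \<in> Z then 1 - p else 1)"
    using assms by (simp add: measure_Pi_pmf_Pi measure_pmf_single if_distrib cong: if_cong)
  also have "\<dots> = (1 - p) ^ card Z"
    using assms by (simp add: prod.If_cases Int_absorb1 flip: Int_def)
  finally show ?thesis .
qed

text \<open>With class sizes \<open>a\<close>, \<open>a\<close>, \<open>b\<close>, \<open>b\<close>
  and \<open>a + b = m\<close>, the number of forbidden pairs is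
  \<open>a^2 + b^2 \<ge> m^2 / 2\<close>, because \<open>(a - b)^2 \<ge> 0\<close>. They are absent
  independently, and \<open>1 - p \<le> exp (- p)\<close>.\<close>

lemma prob_no_edges_le:
  assumes fin: "finite V" and p: "0 \<le> p" "p \<le> 1"
    and x: "card {v \<in> V. f v = (0::nat)} = card {v \<in> V. f v = 1}"
    and y: "card {v \<in> V. f v = 2} = card {v \<in> V. f v = 3}"
    and m: "card {v \<in> V. f v = 0} + card {v \<in> V. f v = 2} = m"
  shows "measure_pmf.prob (Pi_pmf ([V]\<^bsup>2\<^esup>) False (\<lambda>_. bernoulli_pmf p))
    {\<omega>. \<forall>u\<in>V. \<forall>v\<in>V. f u = 0 \<and> f v = 1 \<or> f u = 2 \<and> f v = 3 \<longrightarrow> \<not> \<omega> {u, v}}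
    \<le> exp (- p * real (m\<^sup>2) / 2)"
proof -
  define cls where "cls j = {v \<in> V. f v = j}" for j
  define Y where "Y = cls 0 \<times> cls 1 \<union> cls 2 \<times> cls 3"
  define Z where "Z = (\<lambda>(u, v). {u, v}) ` Y"
  have fc: "finite (cls j)" for j using fin by (simp add: cls_def)
  \<comment> \<open>The labels are disjoint and fix the order of each pair, so no edge is counted
    twice.\<close>
  have "inj_on (\<lambda>(u, v). {u, v}) Y"
    by (auto simp: inj_on_def Y_def cls_def doubleton_eq_iff)
  then have "card Z = card Y" by (simp add: Z_def card_image)
  also have "\<dots> = card (cls 0 \<times> cls 1) + card (cls 2 \<times> cls 3)"
    unfolding Y_def by (rule card_Un_disjoint) (auto simp: fc, auto simp: cls_def)
  finally have "card Z = card (cls 0) ^ 2 + card (cls 2) ^ 2"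
    using x y by (simp add: cls_def card_cartesian_product power2_eq_square)
  then have cZ: "real (card Z) = real (card (cls 0)) ^ 2 + real (card (cls 2)) ^ 2" by simp
  have "real m = real (card (cls 0)) + real (card (cls 2))" using m by (simp add: cls_def)
  then have mZ: "real (m\<^sup>2) / 2 \<le> real (card Z)"
    unfolding cZ using zero_le_power2[of "real (card (cls 0)) - real (card (cls 2))"]
    by (simp add: power2_eq_square algebra_simps)
  have Z: "Z \<subseteq> [V]\<^bsup>2\<^esup>"
    by (auto simp: Z_def Y_def cls_def)
  have "{\<omega>. \<forall>u\<in>V. \<forall>v\<in>V. f u = 0 \<and> f v = 1 \<or> f u = 2 \<and> f v = 3 \<longrightarrow> \<not> \<omega> {u, v}}
      = {\<omega>. \<forall>e\<in>Z. \<not> \<omega> e}"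
    by (fastforce simp: Z_def Y_def cls_def)
  then have "measure_pmf.prob (Pi_pmf ([V]\<^bsup>2\<^esup>) False (\<lambda>_. bernoulli_pmf p))
    {\<omega>. \<forall>u\<in>V. \<forall>v\<in>V. f u = 0 \<and> f v = 1 \<or> f u = 2 \<and> f v = 3 \<longrightarrow> \<not> \<omega> {u, v}} = (1 - p) ^ card Z"
    using prob_Pi_pmf_bernoulli_all_False[OF _ Z p] fin by (simp add: finite_imp_finite_nsets)
  also have "\<dots> \<le> exp (- p) ^ card Z"
    using p exp_ge_add_one_self[of "- p"] by (intro power_mono) auto
  also have "\<dots> = exp (- p * real (card Z))" by (simp add: exp_of_nat_mult [symmetric] mult.commute)
  also have "\<dots> \<le> exp (- p * real (m\<^sup>2) / 2)"
    using mult_left_mono[OF mZ p(1)] by simp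
  finally show ?thesis .
qed

text \<open>Union bound over the labellings: the first two factors bound their number, the
  exponential bounds the probability of each. The parameter \<open>q\<close> remains free for
  optimisation.\<close>

lemma prob_not_arrows_path_le:
  fixes p q :: real
  assumes p: "0 \<le> p" "p \<le> 1" and q: "0 < q" "q < 1" and N: "2 * m + 2 * n \<le> N"
  shows "measure_pmf.prob (binomial_random_graph N p) {G. \<not> arrows G (path_graph n)}
    \<le> (4 / q) ^ (2 * m) * (1 / (1 - q)) ^ (N - 2 * m) * exp (- p * real (m\<^sup>2) / 2)"
proof -
  define V where "V = {1..N}"
  define M where "M = measure_pmf (Pi_pmf ([V]\<^bsup>2\<^esup>) False (\<lambda>_. bernoulli_pmf p))"
  define L where "L = {f \<in> V \<rightarrow>\<^sub>E {..<5::nat}. card {v \<in> V. f v = 0} = card {v \<in> V. f v = 1}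
    \<and> card {v \<in> V. f v = 2} = card {v \<in> V. f v = 3}
    \<and> card {v \<in> V. f v = 0} + card {v \<in> V. f v = 2} = m}"
  define Ev where "Ev f = {\<omega>. \<forall>u\<in>V. \<forall>v\<in>V. f u = (0::nat) \<and> f v = 1 \<or> f u = 2 \<and> f v = 3
    \<longrightarrow> \<not> \<omega> {u, v}}" for f
  have V: "finite V" "card V = N" by (simp_all add: V_def)
  have "finite (V \<rightarrow>\<^sub>E {..<5::nat})" using V by (intro finite_PiE) auto
  then have finL: "finite L" by (simp add: L_def)
  have "L \<subseteq> {f \<in> V \<rightarrow>\<^sub>E {..<5::nat}. card {v \<in> V. f v < 4} = 2 * m}"
  proof
    fix f assume f: "f \<in> L"
    have "{v \<in> V. f v < 4} = (\<Union>j<4. {v \<in> V. f v = j})" by auto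
    then have "card {v \<in> V. f v < 4} = (\<Sum>j<4. card {v \<in> V. f v = j})"
      using V by (simp only:) (rule card_UN_disjoint; auto)
    with f show "f \<in> {f \<in> V \<rightarrow>\<^sub>E {..<5::nat}. card {v \<in> V. f v < 4} = 2 * m}"
      by (simp add: L_def eval_nat_numeral)
  qed
  then have "card L \<le> card {f \<in> V \<rightarrow>\<^sub>E {..<5::nat}. card {v \<in> V. f v < 4} = 2 * m}"
    using \<open>finite (V \<rightarrow>\<^sub>E {..<5::nat})\<close> by (intro card_mono) auto
  also have "real \<dots> \<le> (4 / q) ^ (2 * m) * (1 / (1 - q)) ^ (N - 2 * m)"
    using card_labellings_le[OF V(1) q, of "2 * m"] V N by simp
  finally have cardL: "real (card L) \<le> (4 / q) ^ (2 * m) * (1 / (1 - q)) ^ (N - 2 * m)" by simp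
  have "measure_pmf.prob (binomial_random_graph N p) {G. \<not> arrows G (path_graph n)}
      = measure M {\<omega>. \<not> arrows (V, {e \<in> [V]\<^bsup>2\<^esup>. \<omega> e}) (path_graph n)}"
    by (simp add: binomial_random_graph_def M_def V_def vimage_def)
  also have "\<dots> \<le> measure M (\<Union>f\<in>L. Ev f)"
  unfolding M_def
  proof (rule measure_pmf.finite_measure_mono)
    show "{\<omega>. \<not> arrows (V, {e \<in> [V]\<^bsup>2\<^esup>. \<omega> e}) (path_graph n)} \<subseteq> (\<Union>f\<in>L. Ev f)"
    proof
      fix \<omega> assume "\<omega> \<in> {\<omega>. \<not> arrows (V, {e \<in> [V]\<^bsup>2\<^esup>. \<omega> e}) (path_graph n)}"
      then have na: "\<not> arrows (V, {e \<in> [V]\<^bsup>2\<^esup>. \<omega> e}) (path_graph n)" by simp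
      obtain f where f: "f \<in> L" and no: "\<And>u v. u \<in> V \<Longrightarrow> v \<in> V \<Longrightarrow>
          f u = 0 \<and> f v = 1 \<or> f u = 2 \<and> f v = 3 \<Longrightarrow> {u, v} \<notin> {e \<in> [V]\<^bsup>2\<^esup>. \<omega> e}"
        using not_arrows_path_labelling[OF V(1) _ na, of m] N V(2) unfolding L_def by blast
      have "\<omega> \<in> Ev f"
        unfolding Ev_def
      proof (intro CollectI ballI impI)
        fix u v assume uv: "u \<in> V" "v \<in> V" "f u = 0 \<and> f v = 1 \<or> f u = 2 \<and> f v = 3"
        \<comment> \<open>Distinctness puts \<open>{u, v}\<close> among the 2-subsets of
          \<open>V\<close>, so a missing edge means that \<open>\<omega>\<close> is false
          there.\<close>
        then have "u \<noteq> v" by auto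
        with uv no[OF uv] show "\<not> \<omega> {u, v}" by simp
      qed
      with f show "\<omega> \<in> (\<Union>f\<in>L. Ev f)" by blast
    qed
  qed simp
  also have "\<dots> \<le> (\<Sum>f\<in>L. measure M (Ev f))"
    unfolding M_def by (rule measure_pmf.finite_measure_subadditive_finite) (auto simp: finL)
  also have "\<dots> \<le> (\<Sum>f\<in>L. exp (- p * real (m\<^sup>2) / 2))"
    unfolding M_def Ev_def
    by (intro sum_mono prob_no_edges_le V p) (auto simp: L_def)
  also have "\<dots> \<le> (4 / q) ^ (2 * m) * (1 / (1 - q)) ^ (N - 2 * m) * exp (- p * real (m\<^sup>2) / 2)"
    using cardL by (simp add: mult_right_mono)
  finally show ?thesis .
qed

section \<open>Exponential decay for \<open>c = 5.28\<close> and \<open>d = 6\<close>\<close>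

lemma abs_nat_round_diff_le:
  fixes x :: real
  assumes "0 \<le> x"
  shows "\<bar>real (nat (round x)) - x\<bar> \<le> 1 / 2"
proof -
  have "0 \<le> round x" using assms by (simp add: round_def)
  then show ?thesis using of_int_round_abs_le[of x] by simp
qed

text \<open>The rate \<open>r\<close> is the exponential of entropy minus exponent, hence below 1.
  The condition \<open>n \<ge> 6\<close> makes \<open>6 / n\<close> a probability.\<close>

lemma prob_not_arrows_path_le_geometric:
  "\<exists>C r :: real. 0 \<le> r \<and> r < 1 \<and> (\<forall>n\<ge>6. measure_pmf.prob
    (binomial_random_graph (nat (round (5.28 * real n))) (6 / real n)) {G. \<not> arrows G (path_graph n)}
    \<le> C * r ^ n)"
proof -
  define \<alpha> \<beta> :: real where "\<alpha> = ln (264 / 41)" and "\<beta> = ln (66 / 25)"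
  have ab: "0 \<le> \<alpha>" "0 \<le> \<beta>" by (simp_all add: \<alpha>_def \<beta>_def)
  \<comment> \<open>\<open>?C\<close> collects the rounding losses:
    \<open>2 m \<le> 3.28 n + 0.5\<close>, \<open>N - 2 m \<le> 2 n + 1\<close>, and
    \<open>7.38 = 3 * 2.46\<close> from squaring \<open>m \<ge> 1.64 n - 0.75\<close>.\<close>
  let ?C = "exp (0.5 * \<alpha> + \<beta> + 7.38)" and ?r = "exp (3.28 * \<alpha> + 2 * \<beta> - 8.0688)"
  have "?r < 1" using entropy_less_exponent by (simp add: \<alpha>_def \<beta>_def)
  moreover have "measure_pmf.prob (binomial_random_graph (nat (round (5.28 * real n))) (6 / real n))
      {G. \<not> arrows G (path_graph n)} \<le> ?C * ?r ^ n" if n: "6 \<le> n" for n :: nat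
  proof -
    define N where "N = nat (round (5.28 * real n))"
    define m where "m = (N - 2 * n) div 2"
    have "\<bar>real N - 132 / 25 * n\<bar> \<le> 1 / 2"
      using abs_nat_round_diff_le[of "5.28 * real n"] by (simp add: N_def)
    then have N: "real N \<le> 132 / 25 * n + 1 / 2" "132 / 25 * n - 1 / 2 \<le> real N"
      by linarith+
    then have "2 * n \<le> N" using n by linarith
    then have m: "2 * m \<le> N - 2 * n" "N - 2 * n \<le> 2 * m + 1" "2 * m + 2 * n \<le> N"
      unfolding m_def by linarith+
    have m1: "real (2 * m) \<le> 82 / 25 * n + 1 / 2" and m2: "real (N - 2 * m) \<le> 2 * n + 1"
      and m3: "41 / 25 * n - 3 / 4 \<le> real m"
      using m N \<open>2 * n \<le> N\<close> by linarith+
    have "(41 / 25 * n - 3 / 4)\<^sup>2 \<le> (real m)\<^sup>2"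
      using m3 n by (intro power_mono) auto
    then have "2.6896 * (real n)\<^sup>2 - 2.46 * n \<le> real (m\<^sup>2)"
      by (simp add: power2_eq_square algebra_simps)
    then have "(2.6896 * (real n)\<^sup>2 - 2.46 * n) * (3 / n) \<le> real (m\<^sup>2) * (3 / n)"
      by (intro mult_right_mono) auto
    moreover have "(2.6896 * (real n)\<^sup>2 - 2.46 * n) * (3 / n) = 8.0688 * n - 7.38"
      using n by (simp add: power2_eq_square field_simps)
    ultimately have sq: "8.0688 * n - 7.38 \<le> real (m\<^sup>2) * (3 / n)" by simp
    \<comment> \<open>\<open>q = 41 / 66 = 3.28 / 5.28\<close> is the limit of
      \<open>2 m / N\<close>, the asymptotically optimal choice.\<close>
    have "measure_pmf.prob (binomial_random_graph N (6 / real n)) {G. \<not> arrows G (path_graph n)}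
        \<le> (4 / (41 / 66)) ^ (2 * m) * (1 / (1 - 41 / 66)) ^ (N - 2 * m) * exp (- (6 / n) * real (m\<^sup>2) / 2)"
      using n m by (intro prob_not_arrows_path_le) auto
    also have "\<dots> = exp \<alpha> ^ (2 * m) * exp \<beta> ^ (N - 2 * m) * exp (- (6 / n) * real (m\<^sup>2) / 2)"
      by (simp add: \<alpha>_def \<beta>_def)
    also have "\<dots> = exp (real (2 * m) * \<alpha> + real (N - 2 * m) * \<beta> - real (m\<^sup>2) * (3 / n))"
      by (simp only: exp_of_nat_mult [symmetric] exp_add [symmetric]) (simp add: field_simps)
    also have "\<dots> \<le> exp ((3.28 * n + 0.5) * \<alpha> + (2 * n + 1) * \<beta> - (8.0688 * n - 7.38))"
      using mult_right_mono[OF m1 ab(1)] mult_right_mono[OF m2 ab(2)] sq by simp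
    also have "\<dots> = exp ((0.5 * \<alpha> + \<beta> + 7.38) + real n * (3.28 * \<alpha> + 2 * \<beta> - 8.0688))"
      by (simp add: algebra_simps)
    also have "\<dots> = ?C * ?r ^ n"
      by (simp only: exp_of_nat_mult exp_add)
    finally show ?thesis
      by (simp only: N_def)
  qed
  ultimately show ?thesis
    by (intro exI[of _ ?C] exI[of _ ?r]) simp
qed

section \<open>Number of edges and the size-Ramsey number\<close>

text \<open>Markov's inequality; writing the edge count as a sum of indicators gives its mean by
  linearity.\<close>

lemma prob_many_edges_le:
  assumes p: "0 \<le> p" "p \<le> 1" and "0 < t"
  shows "measure_pmf.prob (binomial_random_graph N p) {G. t \<le> real (card (edges G))}
    \<le> real (N choose 2) * p / t"
proof -
  define I where "I = [{1..N}]\<^bsup>2\<^esup>"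
  define P where "P = Pi_pmf I False (\<lambda>_. bernoulli_pmf p)"
  have I: "finite I" "card I = N choose 2"
    by (simp_all add: I_def finite_imp_finite_nsets card_nsets)
  have prob_e: "measure_pmf.prob P {\<omega>. \<omega> e} = p" if "e \<in> I" for e
  proof -
    have "measure_pmf.prob P {\<omega>. \<omega> e} = measure_pmf.prob (map_pmf (\<lambda>\<omega>. \<omega> e) P) {True}"
      by (simp add: vimage_def)
    also have "\<dots> = p" using that I p by (simp add: P_def Pi_pmf_component measure_pmf_single)
    finally show ?thesis .
  qed
  have card_eq: "real (card {e \<in> I. \<omega> e}) = (\<Sum>e\<in>I. indicator {\<omega>. \<omega> e} \<omega>)" for \<omega>
    using I by (simp add: indicator_def sum.If_cases Int_def)
  have int_e: "integrable (measure_pmf P) (indicat_real {\<omega>. \<omega> e})" for e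
    by (rule measure_pmf.integrable_const_bound[where B = 1]) (auto simp: indicator_def)
  then have int: "integrable (measure_pmf P) (\<lambda>\<omega>. real (card {e \<in> I. \<omega> e}))"
    unfolding card_eq by (intro Bochner_Integration.integrable_sum)
  have "measure_pmf.prob (binomial_random_graph N p) {G. t \<le> real (card (edges G))}
      = measure_pmf.prob P {\<omega>. t \<le> real (card {e \<in> I. \<omega> e})}"
    by (simp add: binomial_random_graph_def P_def I_def vimage_def)
  also have "\<dots> \<le> measure_pmf.expectation P (\<lambda>\<omega>. real (card {e \<in> I. \<omega> e})) / t"
    using integral_Markov_inequality_measure[OF int, of "{}" t] \<open>0 < t\<close> by simp
  also have "measure_pmf.expectation P (\<lambda>\<omega>. real (card {e \<in> I. \<omega> e})) = real (N choose 2) * p"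
    unfolding card_eq by (subst Bochner_Integration.integral_sum) (simp_all add: int_e prob_e I)
  finally show ?thesis .
qed

lemma size_ramsey_le:
  fixes G :: "nat graph"
  assumes "fin_simple_graph G" "arrows G H"
  shows "size_ramsey H \<le> card (edges G)"
  unfolding size_ramsey_def using assms by (intro Least_le) blast

lemma fin_simple_graph_binomial_random_graph:
  assumes "G \<in> set_pmf (binomial_random_graph N p)"
  shows "fin_simple_graph G"
  using assms by (auto simp: binomial_random_graph_def fin_simple_graph_def)

theorem theorem3p5:
  fixes c d :: real
  assumes "c = 5.28" and "d = 6"
  shows "(\<lambda>n::nat. measure_pmf.prob (binomial_random_graph (nat (round (c * real n))) (d / real n))
            {G. arrows G (path_graph n)}) \<longlonglongrightarrow> 1
         \<and> (\<forall>\<^sub>F n in sequentially. real (size_ramsey (path_graph n)) < 83.7 * real n)"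
proof
  define \<G> where "\<G> n = binomial_random_graph (nat (round (c * real n))) (d / real n)" for n
  define bad where "bad n = measure_pmf.prob (\<G> n) {G. \<not> arrows G (path_graph n)}" for n
  obtain C r :: real where r: "0 \<le> r" "r < 1"
    and geometric: "\<forall>n\<ge>6. measure_pmf.prob
      (binomial_random_graph (nat (round (5.28 * real n))) (6 / real n)) {G. \<not> arrows G (path_graph n)}
      \<le> C * r ^ n"
    using prob_not_arrows_path_le_geometric by (elim exE conjE)
  have bad: "bad n \<le> C * r ^ n" if "6 \<le> n" for n
    using geometric[rule_format, OF that] by (simp only: bad_def \<G>_def assms)
  have "(\<lambda>n. C * r ^ n) \<longlonglongrightarrow> 0"
    using tendsto_mult_right_zero[OF LIMSEQ_realpow_zero[OF r]] by blast
  moreover have "eventually (\<lambda>n. bad n \<le> C * r ^ n) sequentially"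
    using bad by (auto simp: eventually_sequentially)
  ultimately have lim: "bad \<longlonglongrightarrow> 0"
    by (intro tendsto_sandwich[of "\<lambda>_. 0" bad]) (auto simp: bad_def)
  have "measure_pmf.prob (\<G> n) {G. arrows G (path_graph n)} = 1 - bad n" for n
    using measure_pmf.prob_compl[of "{G. \<not> arrows G (path_graph n)}" "\<G> n"]
    by (simp add: bad_def Compl_eq_Diff_UNIV [symmetric] Collect_neg_eq)
  then show "(\<lambda>n. measure_pmf.prob (binomial_random_graph (nat (round (c * real n))) (d / real n))
      {G. arrows G (path_graph n)}) \<longlonglongrightarrow> 1"
    using tendsto_diff[OF tendsto_const lim, of 1] by (simp add: \<G>_def)
  \<comment> \<open>The Markov bound below is under \<open>0.9996\<close>, as
    \<open>13.943025 * 6 / 83.7\<close> is about \<open>0.9995\<close>; \<open>0.0004\<close> is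
    what remains up to 1. From \<open>n = 1000\<close> on, the lower-order terms of
    \<open>N^2\<close> fit into \<open>0.00765 n^2\<close>.\<close>
  have "eventually (\<lambda>n. bad n < 0.0004) sequentially"
    using lim by (rule order_tendstoD) simp
  then show "\<forall>\<^sub>F n in sequentially. real (size_ramsey (path_graph n)) < 83.7 * real n"
    using eventually_ge_at_top[of 1000]
  proof eventually_elim
    case (elim n)
    define N where "N = nat (round (c * real n))"
    have "\<bar>real N - 132 / 25 * n\<bar> \<le> 1 / 2"
      using abs_nat_round_diff_le[of "5.28 * real n"] by (simp add: N_def assms)
    then have "real N \<le> 132 / 25 * n + 1 / 2" by linarith
    then have "(real N)\<^sup>2 \<le> (132 / 25 * n + 1 / 2)\<^sup>2" by (intro power_mono) auto
    also have "\<dots> = 27.8784 * (real n)\<^sup>2 + 5.28 * n + 0.25"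
      by (simp add: power2_eq_square algebra_simps)
    also have "\<dots> \<le> 27.88605 * (real n)\<^sup>2"
    proof -
      have "1000 * real n \<le> (real n)\<^sup>2" using elim(2) by (simp add: power2_eq_square)
      then show ?thesis using elim(2) by simp
    qed
    finally have N2: "(real N)\<^sup>2 \<le> 27.88605 * (real n)\<^sup>2" .
    have "2 * (N choose 2) \<le> N * (N - 1)"
      by (simp only: choose_two times_div_less_eq_dividend)
    also have "\<dots> \<le> N\<^sup>2" by (simp add: power2_eq_square)
    finally have "2 * (N choose 2) \<le> N\<^sup>2" .
    then have "2 * real (N choose 2) \<le> (real N)\<^sup>2" by (metis of_nat_le_iff of_nat_mult of_nat_numeral of_nat_power)
    with N2 have ch: "real (N choose 2) \<le> 13.943025 * (real n)\<^sup>2" by simp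
    define many where "many = {G :: nat graph. 83.7 * n \<le> real (card (edges G))}"
    have "measure_pmf.prob (\<G> n) many \<le> real (N choose 2) * (6 / n) / (83.7 * n)"
      unfolding many_def \<G>_def N_def assms using elim(2)
      by (intro prob_many_edges_le) auto
    also have "\<dots> \<le> 13.943025 * (real n)\<^sup>2 * (6 / n) / (83.7 * n)"
      using ch by (intro divide_right_mono mult_right_mono) auto
    also have "\<dots> < 0.9996" using elim(2) by (simp add: power2_eq_square field_simps)
    finally have lt: "measure_pmf.prob (\<G> n) many + bad n < 1" using elim(1) by simp
    \<comment> \<open>Probabilistic method: the two bad events have total probability below 1, so
      some graph in the support avoids both.\<close>
    have "\<not> set_pmf (\<G> n) \<subseteq> many \<union> {G. \<not> arrows G (path_graph n)}"
    proof
      assume "set_pmf (\<G> n) \<subseteq> many \<union> {G. \<not> arrows G (path_graph n)}"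
      then have "measure_pmf.prob (\<G> n) (many \<union> {G. \<not> arrows G (path_graph n)}) = 1"
        by (subst measure_pmf.prob_eq_1) (auto simp: AE_measure_pmf_iff)
      moreover have "measure_pmf.prob (\<G> n) (many \<union> {G. \<not> arrows G (path_graph n)})
          \<le> measure_pmf.prob (\<G> n) many + bad n"
        unfolding bad_def by (rule measure_Un_le) auto
      ultimately show False using lt by simp
    qed
    then obtain G where G: "G \<in> set_pmf (\<G> n)" "G \<notin> many" "arrows G (path_graph n)" by auto
    have "size_ramsey (path_graph n) \<le> card (edges G)"
      using G fin_simple_graph_binomial_random_graph unfolding \<G>_def by (intro size_ramsey_le) auto
    with G(2) show ?case by (simp add: many_def)
  qed
qed

end
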